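(* Let $C,K,M,N$ be positive integers. Consider a training process of a convolutional filter $\mathbf{W}\in\mathbb{R}^{C\times K\times K}$, each step of which is a gradient descent step $\mathbf{W}\mapsto\mathbf{W}'=\mathbf{W}-\eta\frac{\partial \mathrm{Loss}}{\partial\mathbf{W}}$ with learning rate $\eta\in\mathbb{R}$, where $\mathrm{Loss}$ is a real-valued differentiable function of the output $Y=\mathbf{W}\otimes\mathbf{X}+b\cdot\mathbf{1}_{M\times N}$ (convolution with circular padding and stride $1$, bias $b\in\mathbb{R}$), regarded as a function of $\mathbf{W}$ through $Y$. Suppose that (at each step) the input feature $\mathbf{X}\in\mathbb{R}^{C\times M\times N}$ contains only the fundamental frequency component, i.e. $\mathcal{F}_{\mathbf{X}}^{(uv)}=0$ for all integer frequencies $(u,v)\neq(0,0)$ with $0\le u\le M-1$, $0\le v\le N-1$. Then the frequency components $\mathcal{F}_{\mathbf{W}}^{(uv)}$ at the frequencies in the set $$S=\{(u,v)\in[0,M)\times[0,N)\ :\ u=jM/K \text{ for some } j\in\{1,\dots,K-1\},\ \text{or}\ v=lN/K\text{ for some } l\in\{1,\dots,K-1\}\}$$ remain invariant: at each step, $$\forall (u,v)\in S,\qquad \Delta\mathcal{F}_{\mathbf{W}}^{(uv)}=\mathcal{F}_{\mathbf{W}'}^{(uv)}-\mathcal{F}_{\mathbf{W}}^{(uv)}=\mathbf{0}.$$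
   Context: Here $i=\sqrt{-1}$ and $\mathbf{1}_{M\times N}$ is the all-ones matrix. Convolution: writing $W^{(c)}_{ts}$ ($0\le t,s\le K-1$) and $X^{(c)}_{mn}$ ($0\le m\le M-1$, $0\le n\le N-1$) for the entries of the $c$-th channels ($1\le c\le C$) of $\mathbf{W}$ and $\mathbf{X}$, $$Y_{mn}=b+\sum_{c=1}^{C}\sum_{t=0}^{K-1}\sum_{s=0}^{K-1}W^{(c)}_{ts}X^{(c)}_{m+t,\,n+s},$$ where the spatial indices of $X^{(c)}$ are taken modulo $M$ and $N$ respectively (circular padding). Frequency components of the input: for integers $0\le u\le M-1$, $0\le v\le N-1$, $G^{(c)}_{uv}=\sum_{m=0}^{M-1}\sum_{n=0}^{N-1}X^{(c)}_{mn}e^{-i(\frac{um}{M}+\frac{vn}{N})2\pi}$ and $\mathcal{F}_{\mathbf{X}}^{(uv)}=[G^{(1)}_{uv},\dots,G^{(C)}_{uv}]^\top\in\mathbb{C}^C$. Frequency components of the filter: for real $u,v$ (not necessarily integers), $\mathcal{F}_{\mathbf{W}}^{(uv)}=\mathcal{T}_{uv}(\mathbf{W})=[Q^{(1)}_{uv},\dots,Q^{(C)}_{uv}]^\top\in\mathbb{C}^C$ with $Q^{(c)}_{uv}=\sum_{t=0}^{K-1}\sum_{s=0}^{K-1}W^{(c)}_{ts}e^{i(\frac{ut}{M}+\frac{vs}{N})2\pi}$. *)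

theory Defs
  imports "HOL-Analysis.Analysis"
begin

text \<open>
  A real array of size \<open>C \<times> K \<times> K\<close> is an element of \<open>real ^ 'k ^ 'k ^ 'c\<close>, entry
  \<open>(c, t, s)\<close> being \<open>W $ c $ t $ s\<close>; spatial inputs and outputs are treated in the same way.
  The sizes \<open>C, K, M, N\<close> are the cardinalities of the index types, hence positive. The order on
  \<open>'k\<close>, \<open>'m\<close>, \<open>'n\<close> only serves to number their elements from \<open>0\<close> to \<open>CARD('a) - 1\<close>;
  every positive cardinality occurs, for instance among the numeral types.
\<close>

definition pos :: "'a::{finite,linorder} \<Rightarrow> nat" where
  "pos i = card {..<i}"

lemma bij_betw_pos: "bij_betw pos (UNIV :: 'a::{finite,linorder} set) {..<CARD('a)}"
proof -
  have mono: "pos i < pos j" if "i < j" for i j :: 'a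
    unfolding pos_def using that by (intro psubset_card_mono) auto
  have inj: "inj (pos :: 'a \<Rightarrow> nat)"
  proof (rule injI)
    fix i j :: 'a assume "pos i = pos j"
    then show "i = j" using mono[of i j] mono[of j i] by (cases i j rule: linorder_cases) auto
  qed
  have lt: "pos i < CARD('a)" for i :: 'a
    unfolding pos_def by (intro psubset_card_mono) auto
  have "pos ` (UNIV :: 'a set) = {..<CARD('a)}"
    by (rule card_subset_eq) (auto simp: lt card_image[OF inj])
  with inj show ?thesis by (simp add: bij_betw_def)
qed

text \<open>The element of \<open>'a\<close> whose number is congruent to \<open>k\<close> modulo \<open>CARD('a)\<close>.\<close>

definition at_pos :: "nat \<Rightarrow> 'a::{finite,linorder}" where
  "at_pos k = (THE i. pos i = k mod CARD('a))"

lemma pos_at_pos: "pos (at_pos k :: 'a::{finite,linorder}) = k mod CARD('a)"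
proof -
  have "k mod CARD('a) \<in> pos ` (UNIV :: 'a set)"
    using bij_betw_pos[where 'a='a] by (simp add: bij_betw_def)
  then obtain i :: 'a where i: "pos i = k mod CARD('a)" by auto
  have "inj (pos :: 'a \<Rightarrow> nat)"
    using bij_betw_pos by (rule bij_betw_imp_inj_on)
  then have "\<exists>!i::'a. pos i = k mod CARD('a)"
    using i by (metis injD)
  then show ?thesis unfolding at_pos_def by (rule theI')
qed

definition conv ::
  "real ^ 'k::{finite,linorder} ^ 'k::_ ^ 'c::finite
    \<Rightarrow> real ^ 'n::{finite,linorder} ^ 'm::{finite,linorder} ^ 'c \<Rightarrow> real ^ 'n::_ ^ 'm::_" where
  "conv W X = (\<chi> m n. \<Sum>c\<in>UNIV. \<Sum>t\<in>UNIV. \<Sum>s\<in>UNIV.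
     W $ c $ t $ s * X $ c $ at_pos (pos m + pos t) $ at_pos (pos n + pos s))"

definition conv_output ::
  "real ^ 'k::{finite,linorder} ^ 'k::_ ^ 'c::finite
    \<Rightarrow> real ^ 'n::{finite,linorder} ^ 'm::{finite,linorder} ^ 'c \<Rightarrow> real \<Rightarrow> real ^ 'n::_ ^ 'm::_" where
  "conv_output W X b = conv W X + b *\<^sub>R (\<chi> m n. 1)"

definition input_freq ::
  "real ^ 'n::{finite,linorder} ^ 'm::{finite,linorder} ^ 'c::finite
    \<Rightarrow> nat \<Rightarrow> nat \<Rightarrow> complex ^ 'c::_" where
  "input_freq X u v = (\<chi> c. \<Sum>m\<in>UNIV. \<Sum>n\<in>UNIV. of_real (X $ c $ m $ n) *
     exp (- (\<i> * of_real ((real (u * pos m) / real CARD('m) +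
       real (v * pos n) / real CARD('n)) * (2 * pi)))))"

text \<open>The spatial size \<open>M \<times> N\<close> of the input is a parameter, as the filter does not determine it.\<close>

definition filter_freq ::
  "nat \<Rightarrow> nat \<Rightarrow> real ^ 'k::{finite,linorder} ^ 'k::_ ^ 'c::finite
    \<Rightarrow> real \<Rightarrow> real \<Rightarrow> complex ^ 'c::_" where
  "filter_freq M N W u v = (\<chi> c. \<Sum>t\<in>UNIV. \<Sum>s\<in>UNIV. of_real (W $ c $ t $ s) *
     exp (\<i> * of_real ((u * real (pos t) / real M + v * real (pos s) / real N) * (2 * pi))))"

definition only_fundamental ::
  "real ^ 'n::{finite,linorder} ^ 'm::{finite,linorder} ^ 'c::finite \<Rightarrow> bool" where
  "only_fundamental X \<longleftrightarrow>
     (\<forall>u<CARD('m). \<forall>v<CARD('n). (u, v) \<noteq> (0, 0) \<longrightarrow> input_freq X u v = 0)"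

definition invariant_freqs :: "nat \<Rightarrow> nat \<Rightarrow> nat \<Rightarrow> (real \<times> real) set" where
  "invariant_freqs K M N = {(u, v). 0 \<le> u \<and> u < real M \<and> 0 \<le> v \<and> v < real N \<and>
     ((\<exists>j\<in>{1..K - 1}. u = real j * real M / real K) \<or>
      (\<exists>l\<in>{1..K - 1}. v = real l * real N / real K))}"

text \<open>
  On \<open>real ^ 'k ^ 'k ^ 'c\<close> the inner product is the sum of the entrywise products, so this is
  the array of partial derivatives wherever the function is differentiable.
\<close>

definition grad :: "('a::real_inner \<Rightarrow> real) \<Rightarrow> 'a \<Rightarrow> 'a" where
  "grad f x = (THE D. GDERIV f x :> D)"

lemma grad_eqI:
  assumes "GDERIV f x :> D"
  shows "grad f x = D"
  unfolding grad_def
proof (rule the_equality)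
  fix E assume "GDERIV f x :> E"
  with assms have "(\<lambda>h. inner h E) = (\<lambda>h. inner h D)"
    unfolding gderiv_def by (blast intro: has_derivative_unique)
  then have "inner (E - D) E = inner (E - D) D" by (rule fun_cong)
  then have "inner (E - D) (E - D) = 0" by (simp add: inner_diff_right)
  then show "E = D" by simp
qed (fact assms)

definition gd_step ::
  "real \<Rightarrow> (real ^ 'n::_ ^ 'm::_ \<Rightarrow> real)
    \<Rightarrow> real ^ 'n::{finite,linorder} ^ 'm::{finite,linorder} ^ 'c::finite \<Rightarrow> real
    \<Rightarrow> real ^ 'k::{finite,linorder} ^ 'k::_ ^ 'c \<Rightarrow> real ^ 'k::_ ^ 'k::_ ^ 'c::_" where
  "gd_step \<eta> Loss X b W = W - \<eta> *\<^sub>R grad (\<lambda>V. Loss (conv_output V X b)) W"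

end

theory Submission
  imports Defs
begin

text \<open>
  By the inverse discrete Fourier transform, an input containing only the fundamental frequency is
  constant on each channel. The output then depends on the filter only through the sums of its
  channels, so the gradient of the loss is constant on each channel as well. The transform of such
  an array at a frequency in \<open>S\<close> has as a factor the sum of the powers of a nontrivial \<open>K\<close>-th
  root of unity, which vanishes.
\<close>

text \<open>Angles are counted in full turns, so that equality with 1 becomes membership in
  \<open>\<int>\<close>.\<close>

definition unit_exp :: "real \<Rightarrow> complex" where
  "unit_exp r = exp (\<i> * of_real (r * (2 * pi)))"

lemma unit_exp_0 [simp]: "unit_exp 0 = 1"
  by (simp add: unit_exp_def)

lemma unit_exp_add: "unit_exp (r + s) = unit_exp r * unit_exp s"
  by (simp add: unit_exp_def exp_add algebra_simps)

lemma unit_exp_mult_of_nat: "unit_exp (real n * r) = unit_exp r ^ n"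
  by (induction n) (simp_all add: unit_exp_add algebra_simps)

lemma unit_exp_eq_1_iff: "unit_exp r = 1 \<longleftrightarrow> r \<in> \<int>"
  unfolding unit_exp_def exp_eq_1 by (auto simp: Ints_def)

text \<open>The sum is geometric with ratio \<open>unit_exp r\<close>, a \<open>K\<close>-th root of
  unity other than 1, so the numerator of the closed form vanishes while the denominator does
  not.\<close>

lemma sum_unit_exp_eq_0:
  assumes "real K * r \<in> \<int>" and "r \<notin> \<int>"
  shows "(\<Sum>t<K. unit_exp (real t * r)) = 0"
proof -
  have "unit_exp r \<noteq> 1" and "unit_exp r ^ K = 1"
    using assms by (simp_all add: unit_exp_eq_1_iff flip: unit_exp_mult_of_nat)
  then show ?thesis
    by (simp add: unit_exp_mult_of_nat geometric_sum)
qed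

lemma fraction_not_Ints:
  assumes "x \<noteq> 0" and "\<bar>x\<bar> < real K"
  shows "x / real K \<notin> \<int>"
proof
  assume "x / real K \<in> \<int>"
  then obtain z :: int where z: "x / real K = of_int z" by (auto elim: Ints_cases)
  have "\<bar>x / real K\<bar> < 1" using assms by (simp add: abs_divide)
  then have "z = 0" unfolding z by linarith
  with z assms show False by auto
qed

text \<open>Orthogonality of the characters of the cyclic group of order \<open>M\<close>: two
  distinct residues differ by less than \<open>M\<close>, so off the diagonal the ratio is a
  nontrivial root of unity.\<close>

lemma sum_unit_exp_orthogonal:
  assumes "a < M" and "b < M"
  shows "(\<Sum>u<M. unit_exp (real u * ((real a - real b) / real M))) = (if a = b then of_nat M else 0)"
proof (cases "a = b")
  case False
  have "(real a - real b) / real M \<notin> \<int>"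
    by (rule fraction_not_Ints) (use assms False in auto)
  moreover have "real M * ((real a - real b) / real M) \<in> \<int>"
    using assms by simp
  ultimately show ?thesis
    using False sum_unit_exp_eq_0 by presburger
qed simp

lemma sum_pos:
  fixes g :: "nat \<Rightarrow> 'b::comm_monoid_add"
  shows "(\<Sum>i\<in>(UNIV :: 'a::{finite,linorder} set). g (pos i)) = (\<Sum>t<CARD('a). g t)"
  by (rule sum.reindex_bij_betw[OF bij_betw_pos])

lemma pos_less: "pos (i :: 'a::{finite,linorder}) < CARD('a)"
  using bij_betw_pos[where 'a='a] by (auto simp: bij_betw_def)

lemma pos_eq_iff: "pos (i :: 'a::{finite,linorder}) = pos j \<longleftrightarrow> i = j"
  using bij_betw_imp_inj_on[OF bij_betw_pos[where 'a='a]] by (auto dest: injD)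

lemma sum_unit_exp_pos:
  fixes m m' :: "'m::{finite,linorder}"
  shows "(\<Sum>u<CARD('m). unit_exp (real u * ((real (pos m') - real (pos m)) / real CARD('m))))
    = (if m = m' then of_nat CARD('m) else 0)"
  using sum_unit_exp_orthogonal[OF pos_less pos_less, of m' m] by (auto simp: pos_eq_iff)

text \<open>Inverse discrete Fourier transform without normalization. Once the frequency sums are
  innermost, orthogonality in each direction leaves only the entry at \<open>m'\<close>,
  \<open>n'\<close>.\<close>

lemma input_freq_inversion:
  fixes X :: "real ^ 'n::{finite,linorder} ^ 'm::{finite,linorder} ^ 'c::finite"
  shows "(\<Sum>u<CARD('m). \<Sum>v<CARD('n). input_freq X u v $ c *
       unit_exp (real u * real (pos m') / real CARD('m) + real v * real (pos n') / real CARD('n)))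
    = of_nat (CARD('m) * CARD('n)) * of_real (X $ c $ m' $ n')"
proof -
  \<comment> \<open>In each direction the forward and the inverse kernel merge into one exponential
    that depends only on the difference of positions.\<close>
  define eM where
    "eM = (\<lambda>u (m::'m). unit_exp (real u * ((real (pos m') - real (pos m)) / real CARD('m))))"
  define eN where
    "eN = (\<lambda>v (n::'n). unit_exp (real v * ((real (pos n') - real (pos n)) / real CARD('n))))"
  have term_eq: "input_freq X u v $ c *
       unit_exp (real u * real (pos m') / real CARD('m) + real v * real (pos n') / real CARD('n))
     = (\<Sum>m\<in>UNIV. \<Sum>n\<in>UNIV. of_real (X $ c $ m $ n) * (eM u m * eN v n))" for u v
  proof -
    have "exp (- (\<i> * of_real ((real (u * pos m) / real CARD('m) +
         real (v * pos n) / real CARD('n)) * (2 * pi)))) *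
       unit_exp (real u * real (pos m') / real CARD('m) + real v * real (pos n') / real CARD('n))
       = eM u m * eN v n" for m :: 'm and n :: 'n
      unfolding eM_def eN_def unit_exp_def exp_add[symmetric]
      by (rule arg_cong[where f=exp]) (simp add: field_simps)
    then show ?thesis
      by (simp add: input_freq_def sum_distrib_right mult.assoc)
  qed
  \<comment> \<open>The sum over \<open>m\<close> is moved outward past \<open>v\<close> and
    \<open>u\<close>, then the sum over \<open>n\<close> likewise.\<close>
  have "(\<Sum>u<CARD('m). \<Sum>v<CARD('n). \<Sum>m\<in>UNIV. \<Sum>n\<in>UNIV.
       of_real (X $ c $ m $ n) * (eM u m * eN v n))
     = (\<Sum>m\<in>UNIV. \<Sum>n\<in>UNIV. \<Sum>u<CARD('m). \<Sum>v<CARD('n).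
       of_real (X $ c $ m $ n) * (eM u m * eN v n))"
    by (subst (2) sum.swap, subst sum.swap, rule sum.cong[OF refl],
        subst (2) sum.swap, subst sum.swap, rule refl)
  also have "\<dots> = (\<Sum>m\<in>UNIV. \<Sum>n\<in>UNIV. of_real (X $ c $ m $ n) *
       ((\<Sum>u<CARD('m). eM u m) * (\<Sum>v<CARD('n). eN v n)))"
    by (simp only: sum_product) (simp only: sum_distrib_left)
  \<comment> \<open>The condition on \<open>n\<close> stands outermost so that the inner sum
    collapses first, then the outer one.\<close>
  also have "\<dots> = (\<Sum>m\<in>UNIV. \<Sum>n\<in>UNIV. if n = n' then if m = m' then
       of_real (X $ c $ m $ n) * of_nat (CARD('m) * CARD('n)) else 0 else 0)"
    unfolding eM_def eN_def sum_unit_exp_pos by (intro sum.cong) auto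
  finally show ?thesis
    by (simp add: term_eq mult.commute)
qed

text \<open>Only the term at frequency (0, 0) survives in the inversion formula, and its kernel
  \<open>unit_exp 0\<close> is 1 at every position.\<close>

lemma only_fundamental_imp_constant:
  fixes X :: "real ^ 'n::{finite,linorder} ^ 'm::{finite,linorder} ^ 'c::finite"
  assumes "only_fundamental X"
  obtains x where "\<And>c m n. X $ c $ m $ n = x c"
proof -
  have zero: "input_freq X u v $ c * z = (if v = 0 then if u = 0 then input_freq X 0 0 $ c * z else 0 else 0)"
    if "u < CARD('m)" "v < CARD('n)" for u v c z
    using assms that by (auto simp: only_fundamental_def)
  have "of_nat (CARD('m) * CARD('n)) * of_real (X $ c $ m $ n) = input_freq X 0 0 $ c" for c m n
    unfolding input_freq_inversion[symmetric, of X c m n] by (simp add: zero cong: sum.cong_simp)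
  \<comment> \<open>The index \<open>undefined\<close> is an arbitrary reference position at which
    the constant of the channel is read off; the positive factor then cancels.\<close>
  then have "of_nat (CARD('m) * CARD('n)) * complex_of_real (X $ c $ m $ n)
      = of_nat (CARD('m) * CARD('n)) * of_real (X $ c $ undefined $ undefined)" for c m n
    by metis
  then have "X $ c $ m $ n = X $ c $ undefined $ undefined" for c m n
    by simp
  then show thesis by (rule that)
qed

text \<open>Every circular shift of a constant channel is the same, so all output positions receive
  the same linear functional of the filter.\<close>

lemma conv_constant_input:
  fixes X :: "real ^ 'n::{finite,linorder} ^ 'm::{finite,linorder} ^ 'c::finite"
    and V :: "real ^ 'k::{finite,linorder} ^ 'k::_ ^ 'c"
  assumes "\<And>c m n. X $ c $ m $ n = x c"
  shows "conv V X = (V \<bullet> (\<chi> c t s. x c)) *\<^sub>R (\<chi> m n. 1)"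
  by (simp add: conv_def assms inner_vec_def vec_eq_iff)

text \<open>Chain rule: varying the filter moves the output only along the all-ones matrix, by an
  amount given by an inner product with a fixed array. The gradient is therefore a multiple of that
  array.\<close>

lemma grad_loss_constant_input:
  fixes X :: "real ^ 'n::{finite,linorder} ^ 'm::{finite,linorder} ^ 'c::finite"
    and V :: "real ^ 'k::{finite,linorder} ^ 'k::_ ^ 'c"
  assumes X: "\<And>c m n. X $ c $ m $ n = x c"
    and L: "L differentiable (at (conv_output V X b))"
  obtains g where "grad (\<lambda>V. L (conv_output V X b)) V = g *\<^sub>R (\<chi> c t s. x c)"
proof -
  let ?D = "\<chi> c t s. x c :: real ^ 'k::{finite,linorder} ^ 'k::_ ^ 'c" and ?E = "\<chi> m n. 1 :: real ^ 'n::{finite,linorder} ^ 'm::{finite,linorder}"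
  obtain L' where L': "(L has_derivative L') (at (conv_output V X b))"
    using L by (auto simp: differentiable_def)
  have out: "conv_output V X b = (V \<bullet> ?D) *\<^sub>R ?E + b *\<^sub>R ?E" for V :: "real ^ 'k::{finite,linorder} ^ 'k::_ ^ 'c"
    by (simp add: conv_output_def conv_constant_input[OF X])
  have "((\<lambda>V. conv_output V X b) has_derivative (\<lambda>h. (h \<bullet> ?D) *\<^sub>R ?E)) (at V)"
    unfolding out by (auto intro!: derivative_eq_intros)
  from has_derivative_compose[OF this L']
  have "((\<lambda>V. L (conv_output V X b)) has_derivative (\<lambda>h. L' ((h \<bullet> ?D) *\<^sub>R ?E))) (at V)" .
  \<comment> \<open>Linearity of \<open>L'\<close> pulls the scalar out and exhibits the vector that
    represents the derivative.\<close>
  also have "(\<lambda>h. L' ((h \<bullet> ?D) *\<^sub>R ?E)) = (\<lambda>h. h \<bullet> (L' ?E *\<^sub>R ?D))"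
    using L' by (simp add: linear_scale[OF has_derivative_linear] fun_eq_iff)
  finally have "grad (\<lambda>V. L (conv_output V X b)) V = L' ?E *\<^sub>R ?D"
    by (intro grad_eqI) (simp add: gderiv_def)
  then show thesis by (rule that)
qed

lemma filter_freq_diff:
  "filter_freq M N (V - V') u v = filter_freq M N V u v - filter_freq M N V' u v"
  by (simp add: filter_freq_def vec_eq_iff sum_subtractf left_diff_distrib)

text \<open>On a constant channel the double sum splits into a product of two geometric sums, one
  per direction, and each of the two alternatives in \<open>invariant_freqs\<close> makes one factor
  vanish.\<close>

lemma filter_freq_constant_eq_0:
  assumes uv: "(u, v) \<in> invariant_freqs CARD('k) M N" and "M > 0" "N > 0"
    and V: "\<And>c t s. V $ c $ t $ s = y c"
  shows "filter_freq M N (V :: real ^ 'k::{finite,linorder} ^ 'k::_ ^ 'c::finite) u v = 0"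
proof -
  \<comment> \<open>This serves both directions: the size \<open>L\<close> cancels and leaves the
    ratio \<open>j / K\<close>, strictly between 0 and 1, with \<open>K\<close> the filter
    size.\<close>
  have vanish: "(\<Sum>t<CARD('k). unit_exp (real t * (w / real L))) = 0"
    if "\<exists>j\<in>{1..CARD('k) - 1}. w = real j * real L / real CARD('k)" "L > 0" for w :: real and L :: nat
  proof -
    from that obtain j where j: "1 \<le> j" "j < CARD('k)" and w: "w / real L = real j / real CARD('k)"
      by force
    show ?thesis
      unfolding w
    proof (rule sum_unit_exp_eq_0)
      show "real j / real CARD('k) \<notin> \<int>" by (rule fraction_not_Ints) (use j in auto)
    qed simp
  qed
  have "filter_freq M N V u v $ c = of_real (y c) *
      ((\<Sum>t<CARD('k). unit_exp (real t * (u / real M))) *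
       (\<Sum>s<CARD('k). unit_exp (real s * (v / real N))))" for c
  proof -
    have "filter_freq M N V u v $ c = (\<Sum>t\<in>UNIV. \<Sum>s\<in>UNIV. of_real (y c) *
      (unit_exp (real (pos (t::'k)) * (u / real M)) * unit_exp (real (pos (s::'k)) * (v / real N))))"
      by (simp add: filter_freq_def V unit_exp_def flip: exp_add) (simp add: algebra_simps)
    also have "\<dots> = of_real (y c) *
      ((\<Sum>t\<in>UNIV. unit_exp (real (pos (t::'k)) * (u / real M))) *
       (\<Sum>s\<in>UNIV. unit_exp (real (pos (s::'k)) * (v / real N))))"
      by (simp only: sum_product) (simp only: sum_distrib_left)
    finally show ?thesis by (simp only: sum_pos[where g="\<lambda>t. unit_exp (real t * r)" for r])
  qed
  moreover have "(\<Sum>t<CARD('k). unit_exp (real t * (u / real M))) = 0 \<or>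
      (\<Sum>s<CARD('k). unit_exp (real s * (v / real N))) = 0"
    using uv vanish \<open>M > 0\<close> \<open>N > 0\<close> unfolding invariant_freqs_def by blast
  ultimately show ?thesis by (auto simp: vec_eq_iff)
qed

theorem corollary3p3:
  fixes T :: nat
    and W :: "nat \<Rightarrow> real ^ 'k::{finite,linorder} ^ 'k::_ ^ 'c::finite"
    and X :: "nat \<Rightarrow> real ^ 'n::{finite,linorder} ^ 'm::{finite,linorder} ^ 'c::_"
    and b \<eta> :: "nat \<Rightarrow> real"
    and Loss :: "nat \<Rightarrow> real ^ 'n::_ ^ 'm::_ \<Rightarrow> real"
  assumes "\<And>\<tau>. \<tau> < T \<Longrightarrow> Loss \<tau> differentiable_on UNIV"
    and "\<And>\<tau>. \<tau> < T \<Longrightarrow> W (Suc \<tau>) = gd_step (\<eta> \<tau>) (Loss \<tau>) (X \<tau>) (b \<tau>) (W \<tau>)"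
    and "\<And>\<tau>. \<tau> < T \<Longrightarrow> only_fundamental (X \<tau>)"
  shows "\<forall>\<tau><T. \<forall>(u, v) \<in> invariant_freqs CARD('k) CARD('m) CARD('n).
           filter_freq CARD('m) CARD('n) (W (Suc \<tau>)) u v
             - filter_freq CARD('m) CARD('n) (W \<tau>) u v = 0"
proof (intro allI impI ballI, clarify)
  fix \<tau> u v
  assume \<tau>: "\<tau> < T" and uv: "(u, v) \<in> invariant_freqs CARD('k) CARD('m) CARD('n)"
  obtain x where x: "\<And>c m n. X \<tau> $ c $ m $ n = x c"
    using only_fundamental_imp_constant[OF assms(3)[OF \<tau>]] by blast
  have "Loss \<tau> differentiable (at (conv_output (W \<tau>) (X \<tau>) (b \<tau>)))"
    using assms(1)[OF \<tau>] by (simp add: differentiable_on_def)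
  from grad_loss_constant_input[OF x this] obtain g where
    g: "grad (\<lambda>V. Loss \<tau> (conv_output V (X \<tau>) (b \<tau>))) (W \<tau>) = g *\<^sub>R (\<chi> c t s. x c)"
    by blast
  \<comment> \<open>The update itself is constant on each channel, so its transform vanishes on the
    set; by additivity this is the change of the transform.\<close>
  have "(W (Suc \<tau>) - W \<tau>) $ c $ t $ s = - (\<eta> \<tau> * g * x c)" for c t s
    unfolding assms(2)[OF \<tau>] gd_step_def g by simp
  from filter_freq_constant_eq_0[OF uv _ _ this]
  show "filter_freq CARD('m) CARD('n) (W (Suc \<tau>)) u v
      - filter_freq CARD('m) CARD('n) (W \<tau>) u v = 0"
    by (simp add: filter_freq_diff)
qed

end
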